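(* Let $D$ be an $\mathrm{NRD}(n,k,\lambda,\mu)$ and let $t=\max\{\lambda,\mu,2\lambda-\mu\}$. If $k-t>\log n$, then $$\zeta(D)\le \dim(D)\le \left\lceil \frac{n\log n}{k-t}\right\rceil .$$
   Context: Digraphs are finite, without loops or multiple arcs (two opposite arcs between a pair of vertices, a digon, are allowed); $\log$ is the natural logarithm. A normally regular digraph $\mathrm{NRD}(n,k,\lambda,\mu)$ is a digraph on $n$ vertices in which each vertex has in-degree and out-degree $k$, and for every pair of distinct vertices $x,y$ the number of common out-neighbours of $x$ and $y$ is $\lambda$ if there is exactly one arc between $x$ and $y$, $\mu$ if there is no arc between them, and $2\lambda-\mu$ if there are arcs in both directions. Here $k,\lambda,\mu$ are integers. Distance $d(w,u)$ in a digraph is the length of a shortest directed path from $w$ to $u$, taken to be $\infty$ if there is none. A resolving set of $D$ is a set $R\subseteq V(D)$ such that for each pair of distinct vertices $u,v\notin R$ there is $w\in R$ with $d(w,u)\ne d(w,v)$. The metric dimension $\dim(D)$ is the least size of a resolving set. Localization game on $D$: one player controls a set of cops, the other an invisible robber. The robber first chooses an initial vertex. In each subsequent round the cops move (each cop may choose any vertex to occupy), and then the robber moves along an arc to an out-neighbour or stays. After each robber move, if the cops occupy $u_1,\dots,u_j$, they receive the vector of distances $d(u_i,x)$, $1\le i\le j$, where $x$ is the robber's vertex. The robber is located if in some round there is a unique vertex the robber can occupy that corresponds to the distance vector received (the cops may use information from previous rounds). The localization number $\zeta(D)$ is the minimum number of cops for which there is a strategy guaranteed to locate the robber in a finite number of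 rounds. *)

theory Defs
  imports Complex_Main "HOL-Library.Extended_Nat" "Graph_Theory.Arc_Walk"
begin

text \<open>The locale \<open>digraph\<close> provides finiteness and excludes loops and parallel arcs;
  digons are allowed.\<close>

locale normally_regular_digraph = digraph D
  for D :: "('a, 'b) pre_digraph" (structure) +
  fixes n :: nat and k lam mu :: int
  assumes card_verts: "card (verts D) = n"
    and in_deg: "v \<in> verts D \<Longrightarrow> int (in_degree D v) = k"
    and out_deg: "v \<in> verts D \<Longrightarrow> int (out_degree D v) = k"
    and common_out_neighbours:
      "\<lbrakk>x \<in> verts D; y \<in> verts D; x \<noteq> y\<rbrakk> \<Longrightarrow>
        int (card {z \<in> verts D. x \<rightarrow>\<^bsub>D\<^esub> z \<and> y \<rightarrow>\<^bsub>D\<^esub> z}) =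
          (if x \<rightarrow>\<^bsub>D\<^esub> y \<and> y \<rightarrow>\<^bsub>D\<^esub> x then 2 * lam - mu
           else if x \<rightarrow>\<^bsub>D\<^esub> y \<or> y \<rightarrow>\<^bsub>D\<^esub> x then lam
           else mu)"

text \<open>The infimum of the empty set in \<open>enat\<close> is \<open>\<infinity>\<close>.\<close>

definition ddist :: "('a, 'b) pre_digraph \<Rightarrow> 'a \<Rightarrow> 'a \<Rightarrow> enat" where
  "ddist G w u = (INF p \<in> {p. pre_digraph.apath G w p u}. enat (length p))"

definition resolving_set :: "('a, 'b) pre_digraph \<Rightarrow> 'a set \<Rightarrow> bool" where
  "resolving_set G R \<longleftrightarrow> R \<subseteq> verts G \<and>
     (\<forall>u \<in> verts G - R. \<forall>v \<in> verts G - R. u \<noteq> v \<longrightarrow> (\<exists>w \<in> R. ddist G w u \<noteq> ddist G w v))"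

definition metric_dimension :: "('a, 'b) pre_digraph \<Rightarrow> nat" where
  "metric_dimension G = (LEAST s. \<exists>R. resolving_set G R \<and> card R = s)"

text \<open>The robber's vertex after round \<open>i\<close> is \<open>r i\<close>; round \<open>0\<close> is the choice of the initial vertex.\<close>

definition robber_walk :: "('a, 'b) pre_digraph \<Rightarrow> (nat \<Rightarrow> 'a) \<Rightarrow> bool" where
  "robber_walk G r \<longleftrightarrow> r 0 \<in> verts G \<and> (\<forall>i. r (Suc i) = r i \<or> r i \<rightarrow>\<^bsub>G\<^esub> r (Suc i))"

text \<open>A strategy maps the list of distance vectors received so far (oldest first) to the cops'
  next positions. The cops' earlier positions are determined by that list and need not be
  recorded. Several cops may share a vertex.\<close>

type_synonym 'a cop_strategy = "enat list list \<Rightarrow> 'a list"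

definition cop_strategy :: "('a, 'b) pre_digraph \<Rightarrow> nat \<Rightarrow> 'a cop_strategy \<Rightarrow> bool" where
  "cop_strategy G c \<sigma> \<longleftrightarrow> (\<forall>h. length (\<sigma> h) = c \<and> set (\<sigma> h) \<subseteq> verts G)"

text \<open>The vectors received in rounds \<open>1, \<dots>, i\<close>. In each round the cops move first, so the
  vector is measured at the robber's new vertex.\<close>

primrec observations ::
    "('a, 'b) pre_digraph \<Rightarrow> 'a cop_strategy \<Rightarrow> (nat \<Rightarrow> 'a) \<Rightarrow> nat \<Rightarrow> enat list list" where
  "observations G \<sigma> r 0 = []"
| "observations G \<sigma> r (Suc i) =
     observations G \<sigma> r i @ [map (\<lambda>u. ddist G u (r (Suc i))) (\<sigma> (observations G \<sigma> r i))]"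

definition possible_positions ::
    "('a, 'b) pre_digraph \<Rightarrow> 'a cop_strategy \<Rightarrow> (nat \<Rightarrow> 'a) \<Rightarrow> nat \<Rightarrow> 'a set" where
  "possible_positions G \<sigma> r i =
     {r' i | r'. robber_walk G r' \<and> observations G \<sigma> r' i = observations G \<sigma> r i}"

text \<open>No vector is received in round \<open>0\<close>, hence \<open>i \<ge> 1\<close>.\<close>

definition locating_strategy :: "('a, 'b) pre_digraph \<Rightarrow> 'a cop_strategy \<Rightarrow> bool" where
  "locating_strategy G \<sigma> \<longleftrightarrow>
     (\<forall>r. robber_walk G r \<longrightarrow> (\<exists>i\<ge>1. \<exists>x. possible_positions G \<sigma> r i = {x}))"

definition localization_number :: "('a, 'b) pre_digraph \<Rightarrow> nat" where
  "localization_number G = (LEAST c. \<exists>\<sigma>. cop_strategy G c \<sigma> \<and> locating_strategy G \<sigma>)"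

end

theory Submission
  imports Defs
begin

text \<open>
  If a vertex \<open>w\<close> has an arc to exactly one of \<open>x\<close> and \<open>y\<close>, then its distance to that one is \<open>1\<close>,
  and its distance to the other is at least \<open>2\<close> unless \<open>w\<close> is the other one itself. Hence a set of
  vertices resolves the digraph as soon as, for each pair \<open>x \<noteq> y\<close>, it meets the set of vertices that
  dominate exactly one of the two. By inclusion--exclusion that set has
  size \<open>2 (k - c)\<close>, where \<open>c\<close> counts the common in-neighbours of \<open>x\<close> and \<open>y\<close>, so a bound \<open>c \<le> t\<close>
  makes it large.

  The definition of a normally regular digraph controls only common out-neighbours. The same numbers
  count common in-neighbours because the adjacency matrix \<open>A\<close> is normal. The hypotheses say that
  \<open>A A\<^sup>T = (k - \<mu>) I + \<mu> J + (\<lambda> - \<mu>) (A + A\<^sup>T)\<close> with constant row and column sums; from this a trace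
  computation gives that the Frobenius norm of \<open>A A\<^sup>T - A\<^sup>T A\<close> is \<open>0\<close>
  (\<open>normal_of_row_products\<close>, \<open>common_in_neighbours_eq_common_out_neighbours\<close>).

  There are fewer than \<open>n\<^sup>2\<close> ordered pairs \<open>x \<noteq> y\<close>. By averaging, some vertex hits at least a
  fraction \<open>2 (k - t) / n\<close> of the pairs not hit so far, so \<open>s\<close> greedy choices leave fewer than
  \<open>n\<^sup>2 exp (- 2 (k - t) s / n)\<close> of them (\<open>greedy_hitting_set\<close>). If \<open>s \<ge> n log n / (k - t)\<close> this is
  less than \<open>1\<close>, that is, every pair is hit.

  For the localization number, let the cops stay on a resolving set of least size. The distance vector of
  the first round determines the vertex of the robber: a vertex outside the set by the resolving
  property, a vertex inside it by the entry \<open>0\<close>.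
\<close>

section \<open>Normality from the row products of a matrix\<close>

text \<open>
  In matrix terms, \<open>P = A A\<^sup>T\<close> and \<open>Q = A\<^sup>T A\<close>. Both are symmetric, and
  \<open>\<parallel>P - Q\<parallel>\<^sup>2 = 2 tr (P (P - Q)) + (tr Q\<^sup>2 - tr P\<^sup>2)\<close>, where \<open>tr P\<^sup>2 = tr Q\<^sup>2\<close> by cyclicity of the trace.
  Replacing the factor \<open>P\<close> by \<open>\<alpha> I + \<beta> J + \<gamma> (A + A\<^sup>T)\<close> reduces the claim to four identities: \<open>I\<close>
  contributes \<open>tr P - tr Q = 0\<close>, \<open>J\<close> contributes the difference of the sums of the squared column sums and
  of the squared row sums, which agree, and \<open>A\<close> and \<open>A\<^sup>T\<close> contribute \<open>0\<close> by cyclicity again.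
\<close>

lemma normal_of_row_products:
  fixes a :: "'v \<Rightarrow> 'v \<Rightarrow> real"
  assumes "finite V"
    and balanced: "\<And>x. x \<in> V \<Longrightarrow> (\<Sum>z\<in>V. a x z) = (\<Sum>z\<in>V. a z x)"
    and rows: "\<And>x y. \<lbrakk>x \<in> V; y \<in> V\<rbrakk> \<Longrightarrow>
      (\<Sum>z\<in>V. a x z * a y z) = \<alpha> * of_bool (x = y) + \<beta> + \<gamma> * (a x y + a y x)"
    and "x \<in> V" "y \<in> V"
  shows "(\<Sum>z\<in>V. a z x * a z y) = (\<Sum>z\<in>V. a x z * a y z)"
proof -
  define P where "P x y = (\<Sum>z\<in>V. a x z * a y z)" for x y
  define Q where "Q x y = (\<Sum>z\<in>V. a z x * a z y)" for x y
  have sym: "P x y = P y x" "Q x y = Q y x" for x y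
    by (simp_all add: P_def Q_def mult.commute)
  have squares: "(\<Sum>x\<in>V. \<Sum>y\<in>V. P x y * P x y) = (\<Sum>z\<in>V. \<Sum>w\<in>V. Q z w * Q z w)"
  proof -
    have "(\<Sum>x\<in>V. \<Sum>y\<in>V. P x y * P x y)
        = (\<Sum>x\<in>V. \<Sum>y\<in>V. \<Sum>z\<in>V. \<Sum>w\<in>V. a x z * a y z * (a x w * a y w))"
      by (simp add: P_def sum_product)
    also have "\<dots> = (\<Sum>x\<in>V. \<Sum>z\<in>V. \<Sum>y\<in>V. \<Sum>w\<in>V. a x z * a y z * (a x w * a y w))"
      by (rule sum.cong[OF refl], rule sum.swap)
    also have "\<dots> = (\<Sum>z\<in>V. \<Sum>x\<in>V. \<Sum>y\<in>V. \<Sum>w\<in>V. a x z * a y z * (a x w * a y w))"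
      by (rule sum.swap)
    also have "\<dots> = (\<Sum>z\<in>V. \<Sum>x\<in>V. \<Sum>w\<in>V. \<Sum>y\<in>V. a x z * a y z * (a x w * a y w))"
      by (rule sum.cong[OF refl], rule sum.cong[OF refl], rule sum.swap)
    also have "\<dots> = (\<Sum>z\<in>V. \<Sum>w\<in>V. \<Sum>x\<in>V. \<Sum>y\<in>V. a x z * a y z * (a x w * a y w))"
      by (rule sum.cong[OF refl], rule sum.swap)
    also have "\<dots> = (\<Sum>z\<in>V. \<Sum>w\<in>V. Q z w * Q z w)"
      by (simp add: Q_def sum_product mult_ac)
    finally show ?thesis .
  qed
  have diagonal: "(\<Sum>x\<in>V. P x x) = (\<Sum>x\<in>V. Q x x)"
    unfolding P_def Q_def by (rule sum.swap)
  have total: "(\<Sum>x\<in>V. \<Sum>y\<in>V. P x y) = (\<Sum>x\<in>V. \<Sum>y\<in>V. Q x y)"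
  proof -
    have "(\<Sum>x\<in>V. \<Sum>y\<in>V. P x y) = (\<Sum>x\<in>V. \<Sum>z\<in>V. \<Sum>y\<in>V. a x z * a y z)"
      unfolding P_def by (rule sum.cong[OF refl], rule sum.swap)
    also have "\<dots> = (\<Sum>z\<in>V. \<Sum>x\<in>V. \<Sum>y\<in>V. a x z * a y z)"
      by (rule sum.swap)
    also have "\<dots> = (\<Sum>z\<in>V. (\<Sum>x\<in>V. a x z) * (\<Sum>y\<in>V. a y z))"
      by (simp add: sum_product)
    also have "\<dots> = (\<Sum>z\<in>V. (\<Sum>x\<in>V. a z x) * (\<Sum>y\<in>V. a z y))"
      by (rule sum.cong[OF refl]) (simp add: balanced)
    also have "\<dots> = (\<Sum>z\<in>V. \<Sum>x\<in>V. \<Sum>y\<in>V. a z x * a z y)"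
      by (simp add: sum_product)
    also have "\<dots> = (\<Sum>x\<in>V. \<Sum>z\<in>V. \<Sum>y\<in>V. a z x * a z y)"
      by (rule sum.swap)
    also have "\<dots> = (\<Sum>x\<in>V. \<Sum>y\<in>V. Q x y)"
      unfolding Q_def by (rule sum.cong[OF refl], rule sum.swap)
    finally show ?thesis .
  qed
  have triangles: "(\<Sum>x\<in>V. \<Sum>y\<in>V. a x y * P x y) = (\<Sum>x\<in>V. \<Sum>y\<in>V. a x y * Q x y)"
  proof -
    have "(\<Sum>x\<in>V. \<Sum>y\<in>V. a x y * P x y) = (\<Sum>x\<in>V. \<Sum>y\<in>V. \<Sum>z\<in>V. a x y * (a x z * a y z))"
      by (simp add: P_def sum_distrib_left)
    also have "\<dots> = (\<Sum>y\<in>V. \<Sum>x\<in>V. \<Sum>z\<in>V. a x y * (a x z * a y z))"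
      by (rule sum.swap)
    also have "\<dots> = (\<Sum>y\<in>V. \<Sum>z\<in>V. \<Sum>x\<in>V. a x y * (a x z * a y z))"
      by (rule sum.cong[OF refl], rule sum.swap)
    also have "\<dots> = (\<Sum>x\<in>V. \<Sum>y\<in>V. a x y * Q x y)"
      by (simp add: Q_def sum_distrib_left mult_ac)
    finally show ?thesis .
  qed
  have triangles': "(\<Sum>x\<in>V. \<Sum>y\<in>V. a y x * (P x y - Q x y)) = 0"
  proof -
    have "(\<Sum>x\<in>V. \<Sum>y\<in>V. a y x * (P x y - Q x y)) = (\<Sum>y\<in>V. \<Sum>x\<in>V. a y x * (P x y - Q x y))"
      by (rule sum.swap)
    also have "\<dots> = (\<Sum>y\<in>V. \<Sum>x\<in>V. a y x * P y x) - (\<Sum>y\<in>V. \<Sum>x\<in>V. a y x * Q y x)"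
      unfolding sum_subtractf[symmetric] right_diff_distrib[symmetric]
      by (intro sum.cong[OF refl]) (metis sym)
    finally show ?thesis using triangles by simp
  qed
  have cross: "(\<Sum>x\<in>V. \<Sum>y\<in>V. P x y * (P x y - Q x y)) = 0"
  proof -
    have "(\<Sum>x\<in>V. \<Sum>y\<in>V. P x y * (P x y - Q x y))
        = (\<Sum>x\<in>V. \<Sum>y\<in>V. \<alpha> * (of_bool (x = y) * (P x y - Q x y)) + \<beta> * (P x y - Q x y)
             + \<gamma> * (a x y * (P x y - Q x y)) + \<gamma> * (a y x * (P x y - Q x y)))"
    proof (intro sum.cong[OF refl])
      fix x y assume "x \<in> V" "y \<in> V"
      then have "P x y = \<alpha> * of_bool (x = y) + \<beta> + \<gamma> * (a x y + a y x)"
        unfolding P_def by (rule rows)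
      then have "P x y * d = \<alpha> * (of_bool (x = y) * d) + \<beta> * d
             + \<gamma> * (a x y * d) + \<gamma> * (a y x * d)" for d
        by (simp only: distrib_left distrib_right mult.assoc)
      then show "P x y * (P x y - Q x y) = \<alpha> * (of_bool (x = y) * (P x y - Q x y))
             + \<beta> * (P x y - Q x y)
             + \<gamma> * (a x y * (P x y - Q x y)) + \<gamma> * (a y x * (P x y - Q x y))" .
    qed
    also have "\<dots> = \<alpha> * (\<Sum>x\<in>V. \<Sum>y\<in>V. of_bool (x = y) * (P x y - Q x y))
             + \<beta> * (\<Sum>x\<in>V. \<Sum>y\<in>V. P x y - Q x y)
             + \<gamma> * (\<Sum>x\<in>V. \<Sum>y\<in>V. a x y * (P x y - Q x y))
             + \<gamma> * (\<Sum>x\<in>V. \<Sum>y\<in>V. a y x * (P x y - Q x y))"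
      by (simp only: sum.distrib sum_distrib_left)
    also have "(\<Sum>x\<in>V. \<Sum>y\<in>V. of_bool (x = y) * (P x y - Q x y)) = (\<Sum>x\<in>V. P x x - Q x x)"
      using \<open>finite V\<close> by (intro sum.cong[OF refl]) (simp add: of_bool_def if_distrib if_distribR cong: if_cong)
    also have "\<dots> = 0" using diagonal by (simp add: sum_subtractf)
    also have "(\<Sum>x\<in>V. \<Sum>y\<in>V. P x y - Q x y) = 0" using total by (simp add: sum_subtractf)
    also have "(\<Sum>x\<in>V. \<Sum>y\<in>V. a x y * (P x y - Q x y)) = 0"
      using triangles by (simp add: sum_subtractf right_diff_distrib)
    finally show ?thesis using triangles' by simp
  qed
  have "(\<Sum>x\<in>V. \<Sum>y\<in>V. (P x y - Q x y)\<^sup>2)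
      = (\<Sum>x\<in>V. \<Sum>y\<in>V. 2 * (P x y * (P x y - Q x y)) + (Q x y * Q x y - P x y * P x y))"
    by (intro sum.cong[OF refl]) (simp add: power2_eq_square algebra_simps)
  also have "\<dots> = 2 * (\<Sum>x\<in>V. \<Sum>y\<in>V. P x y * (P x y - Q x y))
      + ((\<Sum>x\<in>V. \<Sum>y\<in>V. Q x y * Q x y) - (\<Sum>x\<in>V. \<Sum>y\<in>V. P x y * P x y))"
    by (simp only: sum.distrib sum_distrib_left sum_subtractf)
  also have "\<dots> = 0"
    using cross squares by simp
  finally have zero: "(\<Sum>x\<in>V. \<Sum>y\<in>V. (P x y - Q x y)\<^sup>2) = 0" .
  have "(\<Sum>y\<in>V. (P x y - Q x y)\<^sup>2) = 0"
    using zero \<open>finite V\<close> \<open>x \<in> V\<close> by (subst (asm) sum_nonneg_eq_0_iff) (auto intro: sum_nonneg)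
  then have "(P x y - Q x y)\<^sup>2 = 0"
    using \<open>finite V\<close> \<open>y \<in> V\<close> by (subst (asm) sum_nonneg_eq_0_iff) auto
  then show ?thesis by (simp add: P_def Q_def)
qed

section \<open>Greedy hitting sets\<close>

text \<open>
  Double counting the incidences of vertices with the sets not hit so far, some vertex lies in a
  fraction of at least \<open>d / card V\<close> of them. Adding it multiplies their number by at most
  \<open>1 - d / card V \<le> exp (- d / card V)\<close>; the exponential form avoids any case distinction
  on the sign of \<open>1 - d / card V\<close>.
\<close>

lemma greedy_hitting_set:
  fixes d :: real
  assumes "finite V" "V \<noteq> {}" "finite I"
    and large: "\<And>i. i \<in> I \<Longrightarrow> S i \<subseteq> V \<and> d \<le> real (card (S i))"
  shows "\<exists>R\<subseteq>V. card R \<le> s \<and>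
    real (card {i \<in> I. S i \<inter> R = {}}) \<le> real (card I) * exp (- d * real s / real (card V))"
proof (induction s)
  case 0
  show ?case by (rule exI[of _ "{}"]) simp
next
  case (Suc s)
  let ?n = "real (card V)"
  obtain R where R: "R \<subseteq> V" "card R \<le> s"
    and bound: "real (card {i \<in> I. S i \<inter> R = {}}) \<le> real (card I) * exp (- d * real s / ?n)"
    using Suc.IH by blast
  define U where "U = {i \<in> I. S i \<inter> R = {}}"
  have "finite U" using \<open>finite I\<close> by (simp add: U_def)
  have n: "?n > 0" using assms by (simp add: card_gt_0_iff)
  obtain w where w: "w \<in> V" "d * real (card U) / ?n \<le> real (card {i \<in> U. w \<in> S i})"
  proof (rule ccontr)
    assume "\<not> thesis"
    then have "\<forall>w\<in>V. real (card {i \<in> U. w \<in> S i}) < d * real (card U) / ?n"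
      using that by force
    then have "(\<Sum>w\<in>V. real (card {i \<in> U. w \<in> S i})) < (\<Sum>w\<in>V. d * real (card U) / ?n)"
      using assms by (intro sum_strict_mono) auto
    also have "\<dots> = d * real (card U)" using n by simp
    also have "\<dots> = (\<Sum>i\<in>U. d)" by simp
    also have "\<dots> \<le> (\<Sum>i\<in>U. real (card (S i)))"
      using large by (intro sum_mono) (auto simp: U_def)
    \<comment> \<open>Count the pairs of a set not hit so far and one of its elements in both orders.\<close>
    also have "\<dots> = (\<Sum>i\<in>U. \<Sum>w\<in>V. of_bool (w \<in> S i))"
    proof (rule sum.cong[OF refl])
      fix i assume "i \<in> U"
      then have "V \<inter> S i = S i" using large by (auto simp: U_def)
      then show "real (card (S i)) = (\<Sum>w\<in>V. of_bool (w \<in> S i))"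
        using \<open>finite V\<close> by (simp add: Int_def)
    qed
    also have "\<dots> = (\<Sum>w\<in>V. \<Sum>i\<in>U. of_bool (w \<in> S i))" by (rule sum.swap)
    also have "\<dots> = (\<Sum>w\<in>V. real (card {i \<in> U. w \<in> S i}))"
      using \<open>finite U\<close> by (simp add: Int_def)
    finally show False by simp
  qed
  have "{i \<in> I. S i \<inter> insert w R = {}} = U - {i \<in> U. w \<in> S i}"
    by (auto simp: U_def)
  then have "real (card {i \<in> I. S i \<inter> insert w R = {}})
      = real (card U) - real (card {i \<in> U. w \<in> S i})"
    using \<open>finite U\<close> by (simp add: card_Diff_subset of_nat_diff card_mono)
  also have "\<dots> \<le> real (card U) * (1 - d / ?n)"
    using w(2) by (simp add: algebra_simps)
  also have "\<dots> \<le> real (card U) * exp (- d / ?n)"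
    using exp_ge_add_one_self[of "- d / ?n"] by (intro mult_left_mono) auto
  also have "\<dots> \<le> real (card I) * exp (- d * real s / ?n) * exp (- d / ?n)"
    using bound by (intro mult_right_mono) (auto simp: U_def)
  also have "\<dots> = real (card I) * exp (- d * real (Suc s) / ?n)"
    by (simp add: mult.assoc flip: exp_add) (simp add: algebra_simps add_divide_distrib diff_divide_distrib)
  finally have "real (card {i \<in> I. S i \<inter> insert w R = {}})
      \<le> real (card I) * exp (- d * real (Suc s) / ?n)" .
  moreover have "card (insert w R) \<le> Suc s"
    using R(2) card_insert_le_m1[of "Suc s" R w] by simp
  ultimately show ?case using R(1) w(1) by (intro exI[of _ "insert w R"]) auto
qed

section \<open>Distances, resolving sets and cops\<close>

context wf_digraph
begin

lemma ddist_le_one_iff: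
  assumes "w \<in> verts G" "w \<noteq> u"
  shows "ddist G w u \<le> 1 \<longleftrightarrow> w \<rightarrow> u"
proof
  assume "ddist G w u \<le> 1"
  then have "\<not> (\<forall>p. apath w p u \<longrightarrow> 2 \<le> enat (length p))"
  proof (rule contrapos_pn)
    assume "\<forall>p. apath w p u \<longrightarrow> 2 \<le> enat (length p)"
    then have "2 \<le> ddist G w u" unfolding ddist_def by (intro INF_greatest) auto
    then show "\<not> ddist G w u \<le> 1"
      by (auto simp: numeral_eq_enat one_enat_def dest: order_trans)
  qed
  then obtain p where p: "apath w p u" "\<not> 2 \<le> enat (length p)" by blast
  then have "length p \<le> 1" by (simp add: numeral_eq_enat)
  moreover have "p \<noteq> []" using p(1) assms by (auto simp: apath_def awalk_Nil_iff)
  ultimately obtain e where "p = [e]" by (cases p) auto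
  then show "w \<rightarrow> u"
    using p(1) by (auto simp: apath_def awalk_Cons_iff awalk_Nil_iff arcs_ends_def arc_to_ends_def)
next
  assume "w \<rightarrow> u"
  then obtain e where e: "e \<in> arcs G" "tail G e = w" "head G e = u"
    by (auto simp: arcs_ends_def arc_to_ends_def)
  then have "apath w [e] u"
    using assms by (auto simp: apath_def awalk_Cons_iff awalk_Nil_iff)
  then have "ddist G w u \<le> enat (length [e])"
    unfolding ddist_def by (intro INF_lower) simp
  then show "ddist G w u \<le> 1" by (simp add: one_enat_def)
qed

lemma ddist_eq_0_iff:
  assumes "w \<in> verts G"
  shows "ddist G w u = 0 \<longleftrightarrow> w = u"
proof
  assume zero: "ddist G w u = 0"
  show "w = u"
  proof (rule ccontr)
    assume "w \<noteq> u"
    then have "1 \<le> enat (length p)" if "apath w p u" for p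
      using that by (cases p) (auto simp: apath_def awalk_Nil_iff one_enat_def)
    then have "1 \<le> ddist G w u" unfolding ddist_def by (intro INF_greatest) auto
    then show False using zero by simp
  qed
next
  assume "w = u"
  then have "apath w [] u" using assms by (simp add: apath_def awalk_Nil_iff)
  then have "ddist G w u \<le> enat (length ([] :: 'b list))"
    unfolding ddist_def by (intro INF_lower) simp
  then show "ddist G w u = 0" by (simp flip: zero_enat_def)
qed

text \<open>
  A resolving set separates only the vertices outside it. A vertex inside it is
  recognized as the one at distance \<open>0\<close> from itself.
\<close>

lemma resolving_set_determines_vertex:
  assumes "resolving_set G R" "x \<in> verts G" "y \<in> verts G"
    and same: "\<And>w. w \<in> R \<Longrightarrow> ddist G w x = ddist G w y"
  shows "x = y"
proof (cases "x \<in> R \<or> y \<in> R")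
  case True
  then show ?thesis using same[of x] same[of y] ddist_eq_0_iff assms(2,3) by metis
next
  case False
  then show ?thesis using assms unfolding resolving_set_def by blast
qed

text \<open>
  Cops that never leave a resolving set locate the robber in the first round, whatever is
  known about the initial vertex.
\<close>

lemma locating_strategy_of_resolving_set:
  assumes res: "resolving_set G (set us)"
  shows "locating_strategy G (\<lambda>_. us)"
  unfolding locating_strategy_def
proof (intro allI impI)
  fix r assume r: "robber_walk G r"
  have in_verts: "r' 1 \<in> verts G" if "robber_walk G r'" for r'
  proof -
    have "r' 0 \<in> verts G" "r' 1 = r' 0 \<or> r' 0 \<rightarrow> r' 1"
      using that by (auto simp: robber_walk_def)
    then show ?thesis using adj_in_verts(2) by metis
  qed
  have "r' 1 = r 1"
    if "robber_walk G r'" "observations G (\<lambda>_. us) r' 1 = observations G (\<lambda>_. us) r 1" for r'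
  proof (rule resolving_set_determines_vertex[OF res])
    show "ddist G w (r' 1) = ddist G w (r 1)" if "w \<in> set us" for w
      using that \<open>observations G (\<lambda>_. us) r' 1 = observations G (\<lambda>_. us) r 1\<close> by simp
  qed (use in_verts r that in auto)
  then have "possible_positions G (\<lambda>_. us) r 1 = {r 1}"
    using r by (auto simp: possible_positions_def)
  then show "\<exists>i\<ge>1. \<exists>x. possible_positions G (\<lambda>_. us) r i = {x}" by blast
qed

end

lemma (in fin_digraph) localization_number_le_metric_dimension:
  "localization_number G \<le> metric_dimension G"
proof -
  have "resolving_set G (verts G)" by (simp add: resolving_set_def)
  then have "\<exists>s R. resolving_set G R \<and> card R = s" by blast
  from LeastI_ex[OF this] have "\<exists>R. resolving_set G R \<and> card R = metric_dimension G"
    unfolding metric_dimension_def .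
  then obtain R where R: "resolving_set G R" "card R = metric_dimension G" by blast
  then have "R \<subseteq> verts G" by (simp add: resolving_set_def)
  then obtain us where us: "set us = R" "distinct us"
    using finite_distinct_list finite_subset finite_verts by metis
  then have "length us = metric_dimension G" using R(2) distinct_card by fastforce
  then have "cop_strategy G (metric_dimension G) (\<lambda>_. us)"
    using us \<open>R \<subseteq> verts G\<close> by (simp add: cop_strategy_def)
  moreover have "locating_strategy G (\<lambda>_. us)"
    using R(1) us(1) by (intro locating_strategy_of_resolving_set) simp
  ultimately show ?thesis
    unfolding localization_number_def by (intro Least_le) blast
qed

section \<open>Neighbourhoods in normally regular digraphs\<close>

context digraph
begin

lemma card_in_neighbours: "card {z \<in> verts G. z \<rightarrow> v} = in_degree G v"
proof -
  have "bij_betw (tail G) (in_arcs G v) {z \<in> verts G. z \<rightarrow> v}"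
    unfolding bij_betw_def
    by (auto simp: inj_on_def in_arcs_def arcs_ends_def arc_to_ends_def image_iff
        intro!: no_multi_arcs)
  then show ?thesis by (simp add: bij_betw_same_card in_degree_def)
qed

lemma card_out_neighbours: "card {z \<in> verts G. v \<rightarrow> z} = out_degree G v"
proof -
  have "bij_betw (head G) (out_arcs G v) {z \<in> verts G. v \<rightarrow> z}"
    unfolding bij_betw_def
    by (auto simp: inj_on_def out_arcs_def arcs_ends_def arc_to_ends_def image_iff
        intro!: no_multi_arcs)
  then show ?thesis by (simp add: bij_betw_same_card out_degree_def)
qed

end

context normally_regular_digraph
begin

text \<open>
  The adjacency matrix satisfies \<open>normal_of_row_products\<close> with \<open>\<alpha> = k - \<mu>\<close>, \<open>\<beta> = \<mu>\<close> and
  \<open>\<gamma> = \<lambda> - \<mu>\<close>: the value \<open>2 \<lambda> - \<mu>\<close> for digons is exactly what makes the number of common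
  out-neighbours affine in \<open>A + A\<^sup>T\<close>. Entries of its two products count common neighbours.
\<close>

lemma common_in_neighbours_eq_common_out_neighbours:
  assumes "x \<in> verts D" "y \<in> verts D"
  shows "card {z \<in> verts D. z \<rightarrow> x \<and> z \<rightarrow> y} = card {z \<in> verts D. x \<rightarrow> z \<and> y \<rightarrow> z}"
proof -
  define a :: "'a \<Rightarrow> 'a \<Rightarrow> real" where "a x y = of_bool (x \<rightarrow> y)" for x y
  have prod_a: "a u v * a u' v' = of_bool (u \<rightarrow> v \<and> u' \<rightarrow> v')" for u v u' v'
    by (simp add: a_def)
  have count: "(\<Sum>z\<in>verts D. of_bool (p z)) = real (card {z \<in> verts D. p z})" for p
    by (simp add: Int_def)
  have out_sum: "(\<Sum>z\<in>verts D. a v z) = k" if "v \<in> verts D" for v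
    unfolding a_def count card_out_neighbours using out_deg[OF that] by (metis of_int_of_nat_eq)
  have in_sum: "(\<Sum>z\<in>verts D. a z v) = k" if "v \<in> verts D" for v
    unfolding a_def count card_in_neighbours using in_deg[OF that] by (metis of_int_of_nat_eq)
  have "(\<Sum>z\<in>verts D. a z x * a z y) = (\<Sum>z\<in>verts D. a x z * a y z)"
  proof (rule normal_of_row_products[OF finite_verts _ _ assms])
    fix u v assume uv: "u \<in> verts D" "v \<in> verts D"
    show "(\<Sum>z\<in>verts D. a u z * a v z)
        = real_of_int (k - mu) * of_bool (u = v) + real_of_int mu + real_of_int (lam - mu) * (a u v + a v u)"
    proof (cases "u = v")
      case True
      have "a u u = 0" using adj_not_same by (auto simp: a_def)
      moreover have "a u z * a u z = a u z" for z by (simp add: a_def)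
      ultimately show ?thesis using True out_sum[OF uv(1)] by (simp only:) simp
    next
      case False
      have "(\<Sum>z\<in>verts D. a u z * a v z)
          = real_of_int (int (card {z \<in> verts D. u \<rightarrow> z \<and> v \<rightarrow> z}))"
        unfolding prod_a count by simp
      also have "\<dots> = real_of_int mu + real_of_int (lam - mu) * (a u v + a v u)"
        unfolding common_out_neighbours[OF uv False] by (auto simp: a_def algebra_simps)
      finally show ?thesis using False by simp
    qed
  qed (simp add: out_sum in_sum)
  then show ?thesis unfolding prod_a count by simp
qed

lemma card_common_in_neighbours_le:
  assumes "x \<in> verts D" "y \<in> verts D" "x \<noteq> y"
  shows "int (card {z \<in> verts D. z \<rightarrow> x \<and> z \<rightarrow> y}) \<le> Max {lam, mu, 2 * lam - mu}"
  using common_out_neighbours[OF assms]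
    common_in_neighbours_eq_common_out_neighbours[OF assms(1,2)]
  by (auto split: if_splits)

lemma card_distinguishing_in_neighbours_ge:
  assumes "x \<in> verts D" "y \<in> verts D" "x \<noteq> y"
  shows "2 * (k - Max {lam, mu, 2 * lam - mu}) \<le> int (card {z \<in> verts D. (z \<rightarrow> x) \<noteq> (z \<rightarrow> y)})"
proof -
  define X Y where "X = {z \<in> verts D. z \<rightarrow> x}" and "Y = {z \<in> verts D. z \<rightarrow> y}"
  have fin: "finite X" "finite Y" by (simp_all add: X_def Y_def)
  have X: "int (card (X \<inter> Y)) + int (card (X - Y)) = k"
    using card_Int_Diff[OF fin(1), of Y] in_deg[OF assms(1)] by (simp add: X_def card_in_neighbours)
  have Y: "int (card (X \<inter> Y)) + int (card (Y - X)) = k"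
    using card_Int_Diff[OF fin(2), of X] in_deg[OF assms(2)]
    by (simp add: Y_def card_in_neighbours Int_commute)
  have "X \<inter> Y = {z \<in> verts D. z \<rightarrow> x \<and> z \<rightarrow> y}" by (auto simp: X_def Y_def)
  then have common: "int (card (X \<inter> Y)) \<le> Max {lam, mu, 2 * lam - mu}"
    using card_common_in_neighbours_le[OF assms] by (simp only:)
  have "{z \<in> verts D. (z \<rightarrow> x) \<noteq> (z \<rightarrow> y)} = (X - Y) \<union> (Y - X)"
    by (auto simp: X_def Y_def)
  then have "int (card {z \<in> verts D. (z \<rightarrow> x) \<noteq> (z \<rightarrow> y)}) = int (card (X - Y)) + int (card (Y - X))"
    using fin by (simp add: card_Un_disjoint disjoint_iff)
  moreover have "2 * (k - m) \<le> i + j" if "c + i = k" "c + j = k" "c \<le> m" for c i j m :: int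
    using that by presburger
  ultimately show ?thesis using X Y common by (simp only:)
qed

section \<open>The bound on the metric dimension\<close>

lemma resolving_set_if_hits_distinguishing:
  assumes "R \<subseteq> verts D"
    and hits: "\<And>x y. \<lbrakk>x \<in> verts D; y \<in> verts D; x \<noteq> y\<rbrakk> \<Longrightarrow> \<exists>w\<in>R. (w \<rightarrow> x) \<noteq> (w \<rightarrow> y)"
  shows "resolving_set D R"
  unfolding resolving_set_def
proof (intro conjI ballI impI)
  fix u v assume uv: "u \<in> verts D - R" "v \<in> verts D - R" "u \<noteq> v"
  then obtain w where w: "w \<in> R" "(w \<rightarrow> u) \<noteq> (w \<rightarrow> v)" using hits by blast
  then have "w \<in> verts D" "w \<noteq> u" "w \<noteq> v" using uv assms(1) by auto
  then have "ddist D w u \<noteq> ddist D w v" using w(2) ddist_le_one_iff by metis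
  then show "\<exists>w\<in>R. ddist D w u \<noteq> ddist D w v" using w(1) by blast
qed (rule assms(1))

text \<open>
  Ordered pairs suffice: each distinguishing set has at least \<open>2 (k - t)\<close> elements, so the exponential
  factor falls to \<open>n\<^sup>-\<^sup>2\<close>, which beats the fewer than \<open>n\<^sup>2\<close> ordered pairs.
\<close>

lemma metric_dimension_le:
  defines "t \<equiv> Max {lam, mu, 2 * lam - mu}"
  assumes "k > t" and "verts D \<noteq> {}"
    and s: "real s \<ge> real n * ln (real n) / real_of_int (k - t)"
  shows "metric_dimension D \<le> s"
proof -
  define I where "I = {(x, y) \<in> verts D \<times> verts D. x \<noteq> y}"
  define S where "S p = {z \<in> verts D. (z \<rightarrow> fst p) \<noteq> (z \<rightarrow> snd p)}" for p
  have n: "real n > 0" using assms(3) card_verts finite_verts by (auto simp: card_gt_0_iff)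
  have I_sub: "I \<subset> verts D \<times> verts D" using assms(3) by (auto simp: I_def)
  then have "finite I" using finite_verts by (meson finite_SigmaI finite_subset psubset_imp_subset)
  have "card I < card (verts D \<times> verts D)"
    using I_sub by (intro psubset_card_mono) auto
  then have card_I: "real (card I) < real n * real n"
    unfolding card_cartesian_product card_verts by (metis of_nat_less_iff of_nat_mult)
  have large: "S p \<subseteq> verts D \<and> real_of_int (2 * (k - t)) \<le> real (card (S p))" if "p \<in> I" for p
  proof -
    have "2 * (k - t) \<le> int (card (S p))"
      using that card_distinguishing_in_neighbours_ge by (auto simp: I_def S_def t_def)
    then show ?thesis by (auto simp: S_def)
  qed
  obtain R where R: "R \<subseteq> verts D" "card R \<le> s"
    and unhit: "real (card {p \<in> I. S p \<inter> R = {}})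
      \<le> real (card I) * exp (- real_of_int (2 * (k - t)) * real s / real n)"
    using greedy_hitting_set[where S = S and s = s, OF finite_verts assms(3) \<open>finite I\<close>, OF large]
    unfolding card_verts by blast
  have "- real_of_int (2 * (k - t)) * real s / real n \<le> - 2 * ln (real n)"
    using s n \<open>k > t\<close> by (simp add: field_simps)
  then have "exp (- real_of_int (2 * (k - t)) * real s / real n) \<le> exp (- 2 * ln (real n))"
    by simp
  also have "\<dots> = 1 / (real n * real n)"
    using n by (simp add: exp_minus exp_double power2_eq_square field_simps)
  finally have "real (card I) * exp (- real_of_int (2 * (k - t)) * real s / real n)
      \<le> real (card I) * (1 / (real n * real n))"
    by (intro mult_left_mono) auto
  also have "\<dots> < 1" using card_I n by (simp add: field_simps)
  finally have "card {p \<in> I. S p \<inter> R = {}} = 0" using unhit by linarith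
  then have "{p \<in> I. S p \<inter> R = {}} = {}" using \<open>finite I\<close> by (subst (asm) card_0_eq) auto
  then have hit: "S p \<inter> R \<noteq> {}" if "p \<in> I" for p using that by blast
  have "resolving_set D R"
  proof (rule resolving_set_if_hits_distinguishing[OF R(1)])
    fix x y assume "x \<in> verts D" "y \<in> verts D" "x \<noteq> y"
    then have "S (x, y) \<inter> R \<noteq> {}" by (intro hit) (simp add: I_def)
    then show "\<exists>w\<in>R. (w \<rightarrow> x) \<noteq> (w \<rightarrow> y)" by (auto simp: S_def)
  qed
  then have "metric_dimension D \<le> card R"
    unfolding metric_dimension_def by (intro Least_le) blast
  then show ?thesis using R(2) by simp
qed

end

theorem theorem2p2:
  fixes D :: "('a, 'b) pre_digraph" and n :: nat and k lam mu t :: int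
  assumes "normally_regular_digraph D n k lam mu"
    and "t = Max {lam, mu, 2 * lam - mu}"
    and "real_of_int (k - t) > ln (real n)"
  shows "localization_number D \<le> metric_dimension D \<and>
         int (metric_dimension D) \<le> \<lceil>real n * ln (real n) / real_of_int (k - t)\<rceil>"
proof
  interpret normally_regular_digraph D n k lam mu by (rule assms(1))
  show "localization_number D \<le> metric_dimension D"
    by (rule localization_number_le_metric_dimension)
  let ?b = "real n * ln (real n) / real_of_int (k - t)"
  show "int (metric_dimension D) \<le> \<lceil>?b\<rceil>"
  proof (cases "verts D = {}")
    case True
    then have "resolving_set D {}" by (simp add: resolving_set_def)
    then have "metric_dimension D \<le> card ({} :: 'a set)"
      unfolding metric_dimension_def by (intro Least_le) blast
    moreover have "n = 0" using True card_verts by simp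
    ultimately show ?thesis by simp
  next
    case False
    then have "n \<ge> 1" using card_verts finite_verts by (metis One_nat_def Suc_leI card_gt_0_iff)
    then have "ln (real n) \<ge> 0" by simp
    then have "real_of_int (k - t) > 0" using assms(3) by linarith
    then have "?b \<ge> 0" using \<open>ln (real n) \<ge> 0\<close> by simp
    then have "real (nat \<lceil>?b\<rceil>) \<ge> ?b" by linarith
    then have "metric_dimension D \<le> nat \<lceil>?b\<rceil>"
      using metric_dimension_le \<open>real_of_int (k - t) > 0\<close> False assms(2) by simp
    then show ?thesis using \<open>?b \<ge> 0\<close> by linarith
  qed
qed

end
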